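(* Let $d\ge 1$ and let $\mathbb{T}=(T_{ij})$ be a $d\times d$ operator matrix where $T_{ij}\in\mathcal{B}_A(\mathcal{H})$ for all $i,j\in\{1,\dots,d\}$, regarded as an operator on $\mathbb{H}=\oplus_{i=1}^d\mathcal{H}$. Then $$\omega_{\mathbb{A}}(\mathbb{T})\leq \frac{1}{2}\sum_{i=1}^{d}\sqrt{\lambda_i^2+\mu_i^2},$$ where, for each $i\in\{1,\dots,d\}$, $$\lambda_i=\|\Re_A(T_{ii})\|_A+\sqrt{\|\Re_A(T_{ii})\|_A^2+\sum_{j=1,\,j\neq i}^d\|T_{ij}\|_A^2}$$ and $$\mu_i=\|\Im_A(T_{ii})\|_A+\sqrt{\|\Im_A(T_{ii})\|_A^2+\sum_{j=1,\,j\neq i}^d\|T_{ij}\|_A^2}.$$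
   Context: $(\mathcal{H},\langle\cdot\mid\cdot\rangle)$ is a non-trivial complex Hilbert space, $\mathcal{B}(\mathcal{H})$ is the algebra of bounded linear operators on $\mathcal{H}$, and $A\in\mathcal{B}(\mathcal{H})$ is a fixed nonzero positive (semidefinite) operator. Put $\langle x\mid y\rangle_A=\langle Ax\mid y\rangle$ and $\|x\|_A=\langle x\mid x\rangle_A^{1/2}$. An operator $T\in\mathcal{B}(\mathcal{H})$ is $A$-bounded, written $T\in\mathcal{B}_{A^{1/2}}(\mathcal{H})$, if there is $\lambda>0$ with $\|Tx\|_A\le\lambda\|x\|_A$ for all $x\in\mathcal{H}$. For such $T$, $\|T\|_A=\sup\{\|Tx\|_A : x\in\mathcal{H},\ \|x\|_A=1\}$ and the $A$-numerical radius is $\omega_A(T)=\sup\{|\langle Tx\mid x\rangle_A| : x\in\mathcal{H},\ \|x\|_A=1\}$. $\mathcal{B}_A(\mathcal{H})$ is the set of $T\in\mathcal{B}(\mathcal{H})$ for which the equation $AX=T^*A$ has a solution $X\in\mathcal{B}(\mathcal{H})$ (equivalently $\mathcal{R}(T^*A)\subset\mathcal{R}(A)$, where $\mathcal{R}$ denotes range); one has $\mathcal{B}_A(\mathcal{H})\subseteq\mathcal{B}_{A^{1/2}}(\mathcal{H})$. For $T\in\mathcal{B}_A(\mathcal{H})$, $T^{\sharp_A}$ denotes the unique solution $X\in\mathcal{B}(\mathcal{H})$ of $AX=T^*A$ with $\mathcal{R}(X)\subseteq\overline{\mathcal{R}(A)}$, and $$\Re_A(T)=\frac{T+T^{\sharp_A}}{2},\qquad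 \Im_A(T)=\frac{T-T^{\sharp_A}}{2i}.$$ $\mathbb{H}=\oplus_{i=1}^d\mathcal{H}$ has the inner product $\langle x,y\rangle=\sum_{k=1}^d\langle x_k\mid y_k\rangle$, and $\mathbb{A}$ is the $d\times d$ diagonal operator matrix on $\mathbb{H}$ with every diagonal entry equal to $A$. $\omega_{\mathbb{A}}$ is the notion above with $(\mathbb{H},\mathbb{A})$ in place of $(\mathcal{H},A)$. *)

theory Defs
  imports "HOL-Analysis.Analysis"
begin

text \<open>
  Complex inner product spaces are layered on the library class of real inner product
  spaces, so that norm, topology and completeness are the library's.  The complex inner
  product is linear in its first argument; positive definiteness and
  \<open>norm x = sqrt (Re (cinner x x))\<close> come from the real inner product being the real
  part of the complex one.
\<close>

class complex_inner = real_inner +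
  fixes scaleC :: "complex \<Rightarrow> 'a \<Rightarrow> 'a"  (infixr \<open>*\<^sub>C\<close> 75)
    and cinner :: "'a \<Rightarrow> 'a \<Rightarrow> complex"
  assumes scaleC_add_right: "a *\<^sub>C (x + y) = a *\<^sub>C x + a *\<^sub>C y"
    and scaleC_add_left: "(a + b) *\<^sub>C x = a *\<^sub>C x + b *\<^sub>C x"
    and scaleC_scaleC: "a *\<^sub>C (b *\<^sub>C x) = (a * b) *\<^sub>C x"
    and scaleR_scaleC: "r *\<^sub>R x = complex_of_real r *\<^sub>C x"
    and cinner_commute: "cinner x y = cnj (cinner y x)"
    and cinner_add_left: "cinner (x + y) z = cinner x z + cinner y z"
    and cinner_scaleC_left: "cinner (a *\<^sub>C x) y = a * cinner x y"
    and inner_eq_Re_cinner: "x \<bullet> y = Re (cinner x y)"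

class complex_hilbert = complex_inner + banach

instantiation complex :: complex_hilbert
begin

definition scaleC_complex :: "complex \<Rightarrow> complex \<Rightarrow> complex"
  where "scaleC_complex a x = a * x"

definition cinner_complex :: "complex \<Rightarrow> complex \<Rightarrow> complex"
  where "cinner_complex x y = x * cnj y"

instance
  by standard
    (auto simp: scaleC_complex_def cinner_complex_def inner_complex_def algebra_simps
      scaleR_conv_of_real)

end

text \<open>
  The Hilbert space direct sum of copies of \<open>'a\<close> indexed by the finite type \<open>'n\<close>, so the
  number of summands is \<open>CARD('n)\<close>.
\<close>

instantiation vec :: (complex_inner, finite) complex_inner
begin

definition scaleC_vec :: "complex \<Rightarrow> 'a ^ 'b \<Rightarrow> 'a ^ 'b"
  where "scaleC_vec a x = (\<chi> i. a *\<^sub>C (x $ i))"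

definition cinner_vec :: "'a ^ 'b \<Rightarrow> 'a ^ 'b \<Rightarrow> complex"
  where "cinner_vec x y = (\<Sum>i\<in>UNIV. cinner (x $ i) (y $ i))"

instance
proof
  fix a b :: complex and r :: real and x y z :: "'a ^ 'b"
  show "a *\<^sub>C (x + y) = a *\<^sub>C x + a *\<^sub>C y"
    by (simp add: vec_eq_iff scaleC_vec_def scaleC_add_right)
  show "(a + b) *\<^sub>C x = a *\<^sub>C x + b *\<^sub>C x"
    by (simp add: vec_eq_iff scaleC_vec_def scaleC_add_left)
  show "a *\<^sub>C (b *\<^sub>C x) = (a * b) *\<^sub>C x"
    by (simp add: vec_eq_iff scaleC_vec_def scaleC_scaleC)
  show "r *\<^sub>R x = complex_of_real r *\<^sub>C x"
    by (simp add: vec_eq_iff scaleC_vec_def scaleR_scaleC)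
  show "cinner x y = cnj (cinner y x)"
    unfolding cinner_vec_def cnj_sum by (rule sum.cong[OF refl], rule cinner_commute)
  show "cinner (x + y) z = cinner x z + cinner y z"
    by (simp add: cinner_vec_def cinner_add_left sum.distrib)
  show "cinner (a *\<^sub>C x) y = a * cinner x y"
    by (simp add: cinner_vec_def scaleC_vec_def cinner_scaleC_left sum_distrib_left)
  show "x \<bullet> y = Re (cinner x y)"
    by (simp add: cinner_vec_def inner_vec_def inner_eq_Re_cinner)
qed

end

instance vec :: (complex_hilbert, finite) complex_hilbert ..

definition bounded_clinear :: "('a::complex_inner \<Rightarrow> 'b::complex_inner) \<Rightarrow> bool"
  where "bounded_clinear T \<longleftrightarrow> bounded_linear T \<and> (\<forall>c x. T (c *\<^sub>C x) = c *\<^sub>C T x)"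

definition positive_op :: "('a::complex_inner \<Rightarrow> 'a) \<Rightarrow> bool"
  where "positive_op A \<longleftrightarrow> bounded_clinear A \<and> (\<forall>x. cinner (A x) x \<in> \<real>\<^sub>\<ge>\<^sub>0)"

text \<open>On a Hilbert space every bounded operator has exactly one adjoint.\<close>

definition cadjoint :: "('a::complex_hilbert \<Rightarrow> 'a) \<Rightarrow> 'a \<Rightarrow> 'a"
  where "cadjoint T = (THE S. \<forall>x y. cinner (T x) y = cinner x (S y))"

definition cinner_A :: "('a::complex_inner \<Rightarrow> 'a) \<Rightarrow> 'a \<Rightarrow> 'a \<Rightarrow> complex"
  where "cinner_A A x y = cinner (A x) y"

definition norm_A :: "('a::complex_inner \<Rightarrow> 'a) \<Rightarrow> 'a \<Rightarrow> real"
  where "norm_A A x = sqrt (Re (cinner_A A x x))"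

text \<open>
  The suprema below are taken in the reals, hence meaningful when \<open>A\<close> is positive and nonzero
  and \<open>T\<close> is \<open>A\<close>-bounded, which holds in particular for members of \<open>B_A A\<close>.
\<close>

definition opnorm_A :: "('a::complex_inner \<Rightarrow> 'a) \<Rightarrow> ('a \<Rightarrow> 'a) \<Rightarrow> real"
  where "opnorm_A A T = Sup {norm_A A (T x) | x. norm_A A x = 1}"

definition numradius_A :: "('a::complex_inner \<Rightarrow> 'a) \<Rightarrow> ('a \<Rightarrow> 'a) \<Rightarrow> real"
  where "numradius_A A T = Sup {cmod (cinner_A A (T x) x) | x. norm_A A x = 1}"

definition B_A :: "('a::complex_hilbert \<Rightarrow> 'a) \<Rightarrow> ('a \<Rightarrow> 'a) set"
  where "B_A A = {T. bounded_clinear T \<and> (\<exists>X. bounded_clinear X \<and> A \<circ> X = cadjoint T \<circ> A)}"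

definition sharp_A :: "('a::complex_hilbert \<Rightarrow> 'a) \<Rightarrow> ('a \<Rightarrow> 'a) \<Rightarrow> 'a \<Rightarrow> 'a"
  where "sharp_A A T =
    (THE X. bounded_clinear X \<and> A \<circ> X = cadjoint T \<circ> A \<and> range X \<subseteq> closure (range A))"

definition Re_A :: "('a::complex_hilbert \<Rightarrow> 'a) \<Rightarrow> ('a \<Rightarrow> 'a) \<Rightarrow> 'a \<Rightarrow> 'a"
  where "Re_A A T = (\<lambda>x. (1 / 2) *\<^sub>C (T x + sharp_A A T x))"

definition Im_A :: "('a::complex_hilbert \<Rightarrow> 'a) \<Rightarrow> ('a \<Rightarrow> 'a) \<Rightarrow> 'a \<Rightarrow> 'a"
  where "Im_A A T = (\<lambda>x. (1 / (2 * \<i>)) *\<^sub>C (T x - sharp_A A T x))"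

definition op_matrix :: "('n \<Rightarrow> 'n \<Rightarrow> 'a \<Rightarrow> 'a) \<Rightarrow> ('a::complex_inner) ^ 'n::finite \<Rightarrow> 'a ^ 'n"
  where "op_matrix T x = (\<chi> i. \<Sum>j\<in>UNIV. T i j (x $ j))"

definition diag_op :: "('a \<Rightarrow> 'a) \<Rightarrow> ('a::complex_inner) ^ 'n::finite \<Rightarrow> 'a ^ 'n"
  where "diag_op A = op_matrix (\<lambda>i j. if i = j then A else (\<lambda>_. 0))"

end

theory Submission
  imports Defs
begin

text \<open>
  Brackets denote the semi-inner products of \<open>A\<close> and \<open>diag_op A\<close>.  Let \<open>x\<close> have unit seminorm
  for \<open>diag_op A\<close> and put \<open>t\<^sub>i = norm_A A (x $ i)\<close>, so that \<open>\<Sum> t\<^sub>i\<^sup>2 = 1\<close>.  The number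
  \<open>\<langle>T x, x\<rangle>\<close> is the sum over the rows \<open>i\<close> of \<open>z\<^sub>i = \<Sum>\<^sub>j \<langle>T\<^sub>i\<^sub>j x\<^sub>j, x\<^sub>i\<rangle>\<close>, and each row is bounded on
  its own.  The real part of the diagonal term is \<open>\<langle>Re_A T\<^sub>i\<^sub>i x\<^sub>i, x\<^sub>i\<rangle>\<close>, of modulus at most \<open>a t\<^sub>i\<^sup>2\<close>
  with \<open>a\<close> the seminorm of \<open>Re_A T\<^sub>i\<^sub>i\<close>.  By the Cauchy-Schwarz inequality the other terms add at
  most \<open>s t\<^sub>i sqrt (1 - t\<^sub>i\<^sup>2)\<close>, where \<open>s\<^sup>2\<close> is the sum of the squared seminorms of the off-diagonal
  entries of the row.  The quadratic form \<open>a t\<^sup>2 + s t w\<close> on the unit circle is at most the largest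
  eigenvalue \<open>(a + sqrt (a\<^sup>2 + s\<^sup>2)) / 2\<close> of its matrix (\<open>quadratic_form_le_largest_eigenvalue\<close>),
  which gives \<open>\<bar>Re z\<^sub>i\<bar> \<le> lam i / 2\<close>.  The imaginary part is treated in the same way with
  \<open>Im_A T\<^sub>i\<^sub>i\<close>, and \<open>\<bar>z\<^sub>i\<bar> \<le> sqrt (lam i\<^sup>2 + mu i\<^sup>2) / 2\<close> follows.

  Three facts about a single operator make this rigorous.  The adjoint and the distinguished
  \<open>A\<close>-adjoint, which are given as unique objects, exist: both come from the orthogonal projection
  onto a closed subspace (\<open>orthogonal_decomposition\<close>, \<open>cinner_cadjoint\<close>, \<open>sharp_A_solves\<close>).
  The suprema in the operator seminorms are over bounded sets, so that
  \<open>norm_A A (S x) \<le> opnorm_A A S * norm_A A x\<close> for the operators in question: an operator with an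
  \<open>A\<close>-adjoint is \<open>A\<close>-bounded (\<open>adjointable_A_bounded\<close>).  Finally, the quadratic forms of
  \<open>Re_A T\<close> and \<open>Im_A T\<close> are the real and the imaginary part of that of \<open>T\<close>
  (\<open>Re_cinner_A_le\<close>, \<open>Im_cinner_A_le\<close>).
\<close>

section \<open>Complex inner products\<close>

lemma cinner_add_right: "cinner x (y + z) = cinner x y + cinner x z"
  by (metis cinner_add_left cinner_commute complex_cnj_add)

lemma cinner_scaleC_right: "cinner x (a *\<^sub>C y) = cnj a * cinner x y"
  by (metis cinner_commute cinner_scaleC_left complex_cnj_mult)

lemma cinner_zero_left [simp]: "cinner 0 x = 0"
  using cinner_add_left[of 0 0 x] by simp

lemma cinner_zero_right [simp]: "cinner x 0 = 0"
  using cinner_add_right[of x 0 0] by simp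

lemma cinner_minus_left: "cinner (- x) y = - cinner x y"
  using cinner_add_left[of x "- x" y] by (simp add: eq_neg_iff_add_eq_0 add.commute)

lemma cinner_minus_right: "cinner y (- x) = - cinner y x"
  using cinner_add_right[of y x "- x"] by (simp add: eq_neg_iff_add_eq_0 add.commute)

lemma cinner_diff_left: "cinner (x - y) z = cinner x z - cinner y z"
  using cinner_add_left[of x "- y" z] by (simp add: cinner_minus_left)

lemma cinner_diff_right: "cinner z (x - y) = cinner z x - cinner z y"
  using cinner_add_right[of z x "- y"] by (simp add: cinner_minus_right)

lemma cinner_sum_left: "cinner (\<Sum>i\<in>I. f i) y = (\<Sum>i\<in>I. cinner (f i) y)"
  by (induction I rule: infinite_finite_induct) (auto simp: cinner_add_left)

lemma cinner_self: "cinner x x = complex_of_real ((norm x)\<^sup>2)"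
proof -
  have "cnj (cinner x x) = cinner x x"
    using cinner_commute[of x x] by simp
  then have "Im (cinner x x) = 0"
    by (metis Reals_cnj_iff complex_is_Real_iff)
  then show ?thesis
    by (simp add: complex_eq_iff power2_norm_eq_inner inner_eq_Re_cinner)
qed

lemma cinner_self_eq_0_iff [simp]: "cinner x x = 0 \<longleftrightarrow> x = 0"
  by (simp add: cinner_self)

lemma cinner_ext_right: "(\<And>x. cinner x y = cinner x z) \<Longrightarrow> y = z"
  using cinner_self_eq_0_iff[of "y - z"] by (simp add: cinner_diff_right)

lemma norm_scaleC: "norm (c *\<^sub>C x) = cmod c * norm x"
proof -
  have "complex_of_real ((norm (c *\<^sub>C x))\<^sup>2) = c * cnj c * complex_of_real ((norm x)\<^sup>2)"
    unfolding cinner_self[symmetric] by (simp add: cinner_scaleC_left cinner_scaleC_right)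
  also have "\<dots> = complex_of_real ((cmod c * norm x)\<^sup>2)"
    by (simp add: complex_norm_square[symmetric] power_mult_distrib)
  finally have "(norm (c *\<^sub>C x))\<^sup>2 = (cmod c * norm x)\<^sup>2"
    using of_real_eq_iff by blast
  then show ?thesis
    by simp
qed

lemma bounded_linear_scaleC: "bounded_linear (\<lambda>x. c *\<^sub>C x)"
proof (rule bounded_linear_intro[where K = "cmod c"])
  show "c *\<^sub>C r *\<^sub>R x = r *\<^sub>R c *\<^sub>C x" for r and x :: 'a
    by (simp add: scaleR_scaleC scaleC_scaleC mult.commute)
qed (simp_all add: scaleC_add_right norm_scaleC mult.commute)

lemma scaleC_diff_right: "c *\<^sub>C (x - y) = c *\<^sub>C x - c *\<^sub>C y"
  by (rule bounded_linear.linear[OF bounded_linear_scaleC, THEN linear_diff])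

lemma continuous_cinner_left: "continuous_on UNIV (\<lambda>x. cinner x y)"
proof -
  have "cinner x y = Complex (x \<bullet> y) (x \<bullet> (\<i> *\<^sub>C y))" for x
    by (simp add: complex_eq_iff inner_eq_Re_cinner cinner_scaleC_right)
  then show ?thesis
    by (simp add: Complex_eq) (intro continuous_intros)
qed

lemma bounded_clinear_linear: "bounded_clinear T \<Longrightarrow> linear T"
  by (simp add: bounded_clinear_def bounded_linear.linear)

lemma bounded_clinear_scaleC: "bounded_clinear T \<Longrightarrow> T (c *\<^sub>C x) = c *\<^sub>C T x"
  by (simp add: bounded_clinear_def)

lemma bounded_clinear_compose:
  "bounded_clinear S \<Longrightarrow> bounded_clinear T \<Longrightarrow> bounded_clinear (\<lambda>x. S (T x))"
  by (simp add: bounded_clinear_def bounded_linear_compose)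

section \<open>Orthogonal projections and adjoints\<close>

text \<open>
  In finite dimension nearest points come from compactness; here completeness replaces it.
  A minimizing sequence for the distance from \<open>x\<close> to \<open>M\<close> is Cauchy by the parallelogram law,
  because midpoints of its members stay in \<open>M\<close>.
\<close>

lemma nearest_point_exists:
  fixes M :: "'a::{real_inner,banach} set"
  assumes sub: "subspace M" and cl: "closed M"
  shows "\<exists>m\<in>M. \<forall>z\<in>M. norm (x - m) \<le> norm (x - z)"
proof -
  define d where "d = infdist x M"
  have ne: "M \<noteq> {}"
    using subspace_0[OF sub] by auto
  have d0: "0 \<le> d"
    by (simp add: d_def infdist_nonneg)
  have dle: "d \<le> norm (x - z)" if "z \<in> M" for z
    using infdist_le[OF that, of x] by (simp add: d_def dist_norm)
  have "\<exists>m\<in>M. norm (x - m) < d + 1 / Suc n" for n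
  proof -
    have "(INF z\<in>M. dist x z) < d + 1 / Suc n"
      using ne by (simp add: d_def infdist_notempty)
    then show ?thesis
      using cInf_lessD[of "dist x ` M" "d + 1 / Suc n"] ne by (simp add: dist_norm)
  qed
  then obtain m where mM: "\<And>n. m n \<in> M" and md: "\<And>n. norm (x - m n) < d + 1 / Suc n"
    by metis
  have gap: "(norm (m k - m l))\<^sup>2 \<le> 4 * (2 * d + 1) / Suc N" if "N \<le> k" "N \<le> l" for k l N
  proof -
    have near: "(norm (x - m j))\<^sup>2 \<le> d\<^sup>2 + (2 * d + 1) / Suc N" if "N \<le> j" for j
    proof -
      have "1 / real (Suc j) \<le> 1 / real (Suc N)"
        using that by (simp add: frac_le)
      then have "norm (x - m j) \<le> d + 1 / Suc N"
        using md[of j] by linarith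
      then have "(norm (x - m j))\<^sup>2 \<le> (d + 1 / Suc N)\<^sup>2"
        by (intro power_mono) auto
      also have "\<dots> = d\<^sup>2 + 2 * d / Suc N + (1 / Suc N) * (1 / Suc N)"
        by (simp add: power2_eq_square algebra_simps)
      also have "\<dots> \<le> d\<^sup>2 + 2 * d / Suc N + 1 * (1 / Suc N)"
        by (intro add_left_mono mult_right_mono) auto
      finally show ?thesis
        by (simp add: add_divide_distrib)
    qed
    have "(1/2) *\<^sub>R (m k + m l) \<in> M"
      by (intro subspace_scale[OF sub] subspace_add[OF sub] mM)
    from dle[OF this] have "d\<^sup>2 \<le> (norm (x - (1/2) *\<^sub>R (m k + m l)))\<^sup>2"
      using d0 by (rule power_mono)
    moreover have "(norm (m k - m l))\<^sup>2 = 2 * (norm (x - m k))\<^sup>2 + 2 * (norm (x - m l))\<^sup>2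
        - 4 * (norm (x - (1/2) *\<^sub>R (m k + m l)))\<^sup>2"
      by (simp add: power2_norm_eq_inner inner_diff_left inner_diff_right inner_add_left
          inner_add_right inner_commute algebra_simps)
    moreover note near[OF that(1)] near[OF that(2)]
    ultimately have "(norm (m k - m l))\<^sup>2 \<le> 4 * ((2 * d + 1) / Suc N)"
      by linarith
    then show ?thesis
      by simp
  qed
  have "Cauchy m"
  proof (rule CauchyI)
    fix e :: real assume "0 < e"
    obtain N :: nat where "4 * (2 * d + 1) / e\<^sup>2 < real N"
      using reals_Archimedean2 by blast
    then have "4 * (2 * d + 1) < real N * e\<^sup>2"
      using \<open>0 < e\<close> by (simp add: pos_divide_less_eq)
    also have "\<dots> \<le> real (Suc N) * e\<^sup>2"
      by (intro mult_right_mono) auto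
    finally have N: "4 * (2 * d + 1) / Suc N < e\<^sup>2"
      by (subst pos_divide_less_eq) (auto simp: mult.commute)
    have "norm (m k - m l) < e" if "N \<le> k" "N \<le> l" for k l
    proof (rule power2_less_imp_less)
      show "(norm (m k - m l))\<^sup>2 < e\<^sup>2"
        using gap[OF that] N by linarith
    qed (use \<open>0 < e\<close> in simp)
    then show "\<exists>N. \<forall>k\<ge>N. \<forall>l\<ge>N. norm (m k - m l) < e"
      by blast
  qed
  then obtain p where p: "m \<longlonglongrightarrow> p"
    using Cauchy_convergent convergent_def by blast
  have pM: "p \<in> M"
    using cl mM p closed_sequentially by blast
  have "(\<lambda>n. d + 1 / Suc n) \<longlonglongrightarrow> d + 0"
    by (intro tendsto_intros LIMSEQ_Suc[OF lim_1_over_n])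
  moreover have "(\<lambda>n. norm (x - m n)) \<longlonglongrightarrow> norm (x - p)"
    by (intro tendsto_intros p)
  ultimately have "norm (x - p) \<le> d + 0"
    using md by (intro LIMSEQ_le[rotated, OF _ exI[of _ 0]]) (auto intro: less_imp_le)
  then have "norm (x - p) \<le> norm (x - z)" if "z \<in> M" for z
    using dle[OF that] by linarith
  with pM show ?thesis
    by blast
qed

text \<open>
  At a nearest point \<open>m\<close> the quadratic \<open>t \<mapsto> norm (x - m - t z)\<^sup>2\<close> is minimal at \<open>t = 0\<close>, so
  \<open>x - m\<close> is orthogonal to \<open>z\<close>.  Applying this to \<open>z\<close> and to \<open>\<i> z\<close> kills the real and the
  imaginary part of the complex inner product.
\<close>

lemma orthogonal_decomposition:
  fixes M :: "'a::complex_hilbert set"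
  assumes sub: "subspace M" and scl: "\<And>c z. z \<in> M \<Longrightarrow> c *\<^sub>C z \<in> M" and cl: "closed M"
  shows "\<exists>m\<in>M. \<forall>z\<in>M. cinner (x - m) z = 0"
proof -
  obtain m where mM: "m \<in> M" and min: "\<And>z. z \<in> M \<Longrightarrow> norm (x - m) \<le> norm (x - z)"
    using nearest_point_exists[OF sub cl] by blast
  have real_orth: "(x - m) \<bullet> z = 0" if "z \<in> M" for z
  proof (cases "z = 0")
    case False
    \<comment> \<open>The minimizer of \<open>t \<mapsto> norm (x - m - t z)\<^sup>2\<close>.\<close>
    define t where "t = ((x - m) \<bullet> z) / (z \<bullet> z)"
    have zz: "0 < z \<bullet> z"
      using False by simp
    have "m + t *\<^sub>R z \<in> M"
      by (intro subspace_add[OF sub] subspace_scale[OF sub] mM that)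
    from min[OF this] have "(norm (x - m))\<^sup>2 \<le> (norm ((x - m) - t *\<^sub>R z))\<^sup>2"
      by (simp add: algebra_simps power_mono)
    also have "\<dots> = (norm (x - m))\<^sup>2 - 2 * t * ((x - m) \<bullet> z) + t * (t * (z \<bullet> z))"
      by (simp add: power2_norm_eq_inner inner_diff_left inner_diff_right inner_commute
          algebra_simps)
    also have "t * (z \<bullet> z) = (x - m) \<bullet> z"
      using zz by (simp add: t_def)
    finally have "t * ((x - m) \<bullet> z) \<le> 0"
      by simp
    then have "((x - m) \<bullet> z)\<^sup>2 / (z \<bullet> z) \<le> 0"
      by (simp add: t_def power2_eq_square)
    then show ?thesis
      using zz by (simp add: divide_le_0_iff)
  qed simp
  have "cinner (x - m) z = 0" if "z \<in> M" for z
    using real_orth[OF that] real_orth[OF scl[OF that, of \<i>]]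
    by (simp add: complex_eq_iff inner_eq_Re_cinner cinner_scaleC_right)
  with mM show ?thesis
    by blast
qed

lemma orthogonal_projection_exists:
  fixes M :: "'a::complex_hilbert set"
  assumes sub: "subspace M" and scl: "\<And>c z. z \<in> M \<Longrightarrow> c *\<^sub>C z \<in> M" and cl: "closed M"
  shows "\<exists>P. bounded_clinear P \<and> range P \<subseteq> M \<and> (\<forall>x. \<forall>z\<in>M. cinner (x - P x) z = 0)"
proof -
  obtain P where PM: "\<And>x. P x \<in> M" and orth: "\<And>x z. z \<in> M \<Longrightarrow> cinner (x - P x) z = 0"
    using orthogonal_decomposition[OF sub scl cl] by metis
  have unique: "P x = m" if "m \<in> M" "\<And>z. z \<in> M \<Longrightarrow> cinner (x - m) z = 0" for x m
  proof -
    have "m - P x \<in> M"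
      by (intro subspace_diff[OF sub] that PM)
    then have "cinner (x - P x) (m - P x) - cinner (x - m) (m - P x) = 0"
      using orth that(2) by simp
    then show ?thesis
      by (simp flip: cinner_diff_left)
  qed
  have add: "P (x + y) = P x + P y" for x y
  proof (rule unique)
    show "cinner (x + y - (P x + P y)) z = 0" if "z \<in> M" for z
      using orth[OF that, of x] orth[OF that, of y]
      by (simp add: cinner_diff_left cinner_add_left)
  qed (intro subspace_add[OF sub] PM)
  have scale: "P (c *\<^sub>C x) = c *\<^sub>C P x" for c x
  proof (rule unique)
    show "cinner (c *\<^sub>C x - c *\<^sub>C P x) z = 0" if "z \<in> M" for z
      using orth[OF that, of x] by (simp add: cinner_scaleC_left flip: scaleC_diff_right)
  qed (intro scl PM)
  have contr: "norm (P x) \<le> norm x * 1" for x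
  proof -
    have "(x - P x) \<bullet> P x = 0"
      using orth[OF PM, of x x] by (simp add: inner_eq_Re_cinner)
    then have "(norm x)\<^sup>2 = (norm (x - P x))\<^sup>2 + (norm (P x))\<^sup>2"
      by (simp add: power2_norm_eq_inner inner_diff_left inner_diff_right inner_commute)
    then have "(norm (P x))\<^sup>2 \<le> (norm x)\<^sup>2"
      by simp
    then show ?thesis
      by simp
  qed
  have "bounded_linear P"
    by (rule bounded_linear_intro[OF add _ contr]) (simp add: scaleR_scaleC scale)
  then show ?thesis
    using PM orth scale by (intro exI[of _ P]) (auto simp: bounded_clinear_def)
qed

text \<open>
  This is the Riesz representation of the functional \<open>f x = cinner (T x) y\<close>: a vector \<open>v\<close>
  orthogonal to its kernel represents it up to a scalar, since
  \<open>f x *\<^sub>C v - f v *\<^sub>C x\<close> always lies in the kernel.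
\<close>

lemma adjoint_vector_exists:
  fixes T :: "'a::complex_hilbert \<Rightarrow> 'a"
  assumes T: "bounded_clinear T"
  shows "\<exists>s. \<forall>x. cinner (T x) y = cinner x s"
proof -
  define f where "f x = cinner (T x) y" for x
  define M where "M = {x. f x = 0}"
  have lin: "linear T"
    by (rule bounded_clinear_linear[OF T])
  have f_add: "f (u + v) = f u + f v" for u v
    by (simp add: f_def linear_add[OF lin] cinner_add_left)
  have f_diff: "f (u - v) = f u - f v" for u v
    by (simp add: f_def linear_diff[OF lin] cinner_diff_left)
  have f_scale: "f (c *\<^sub>C u) = c * f u" for c u
    by (simp add: f_def bounded_clinear_scaleC[OF T] cinner_scaleC_left)
  have "f 0 = 0"
    by (simp add: f_def linear_0[OF lin])
  then have sub: "subspace M"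
    by (auto simp: subspace_def M_def f_add f_scale scaleR_scaleC)
  have scl: "c *\<^sub>C z \<in> M" if "z \<in> M" for c z
    using that by (simp add: M_def f_scale)
  have "continuous_on UNIV f"
    unfolding f_def
    using T continuous_cinner_left
    by (intro continuous_on_compose2[of UNIV "\<lambda>x. cinner x y" UNIV T])
      (auto simp: bounded_clinear_def linear_continuous_on)
  then have cl: "closed M"
    unfolding M_def by (simp add: closed_Collect_eq)
  show ?thesis
  proof (cases "M = UNIV")
    case True
    then show ?thesis
      by (intro exI[of _ 0]) (auto simp: M_def f_def)
  next
    case False
    then obtain u where u: "u \<notin> M"
      by blast
    obtain m where m: "m \<in> M" and orth: "\<And>z. z \<in> M \<Longrightarrow> cinner (u - m) z = 0"
      using orthogonal_decomposition[OF sub scl cl] by metis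
    define v where "v = u - m"
    have v: "cinner v v \<noteq> 0"
      using u m by (auto simp: v_def)
    define s where "s = cnj (f v / cinner v v) *\<^sub>C v"
    have "f x = cinner x s" for x
    proof -
      have "f x *\<^sub>C v - f v *\<^sub>C x \<in> M"
        by (simp add: M_def f_diff f_scale)
      then have "cinner v (f x *\<^sub>C v - f v *\<^sub>C x) = 0"
        using orth by (simp add: v_def)
      then have "cinner (f x *\<^sub>C v - f v *\<^sub>C x) v = 0"
        by (metis cinner_commute complex_cnj_zero)
      then have "f x * cinner v v = f v * cinner x v"
        by (simp add: cinner_diff_left cinner_scaleC_left)
      then show ?thesis
        using v by (simp add: s_def cinner_scaleC_right field_simps)
    qed
    then show ?thesis
      unfolding f_def by blast
  qed
qed

lemma cinner_cadjoint:
  assumes "bounded_clinear T"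
  shows "cinner (T x) y = cinner x (cadjoint T y)"
proof -
  obtain S where S: "\<forall>x y. cinner (T x) y = cinner x (S y)"
    using adjoint_vector_exists[OF assms] by metis
  have "cadjoint T = S"
    unfolding cadjoint_def
  proof (rule the_equality)
    show "\<forall>x y. cinner (T x) y = cinner x (S y)"
      by (rule S)
  next
    fix S' assume "\<forall>x y. cinner (T x) y = cinner x (S' y)"
    with S have "cinner x (S' y) = cinner x (S y)" for x y
      by simp
    then show "S' = S"
      using cinner_ext_right by blast
  qed
  with S show ?thesis
    by simp
qed

section \<open>The semi-inner product of a positive operator\<close>

text \<open>
  A complex form that is real on the diagonal is Hermitian: the values at \<open>x + y\<close> and at
  \<open>x + \<i> y\<close> show that the imaginary and the real part of \<open>\<langle>A x, y\<rangle> - cnj \<langle>A y, x\<rangle>\<close>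
  vanish.
\<close>

lemma positive_op_hermitian:
  assumes "positive_op A"
  shows "cinner (A x) y = cinner x (A y)"
proof -
  have A: "bounded_clinear A" and Im0: "\<And>u. Im (cinner (A u) u) = 0"
    using assms by (auto simp: positive_op_def complex_nonneg_Reals_iff)
  have lin: "linear A"
    by (rule bounded_clinear_linear[OF A])
  have "Im (cinner (A x) y + cinner (A y) x) = 0"
    using Im0[of "x + y"] Im0[of x] Im0[of y]
    by (simp add: linear_add[OF lin] cinner_add_left cinner_add_right)
  moreover have "Re (cinner (A y) x) - Re (cinner (A x) y) = 0"
    using Im0[of "x + \<i> *\<^sub>C y"] Im0[of x] Im0[of y]
    by (simp add: linear_add[OF lin] cinner_add_left cinner_add_right
        bounded_clinear_scaleC[OF A] cinner_scaleC_left cinner_scaleC_right)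
  ultimately have "cinner (A x) y = cnj (cinner (A y) x)"
    by (simp add: complex_eq_iff)
  then show ?thesis
    using cinner_commute by metis
qed

context
  fixes A :: "'a::complex_hilbert \<Rightarrow> 'a"
  assumes pos: "positive_op A"
begin

lemma linear_positive_op: "linear A"
  using pos by (simp add: positive_op_def bounded_clinear_linear)

lemma cinner_A_commute: "cinner_A A x y = cnj (cinner_A A y x)"
  unfolding cinner_A_def using positive_op_hermitian[OF pos] cinner_commute by metis

lemma cinner_A_add_left: "cinner_A A (x + y) z = cinner_A A x z + cinner_A A y z"
  by (simp add: cinner_A_def linear_add[OF linear_positive_op] cinner_add_left)

lemma cinner_A_add_right: "cinner_A A x (y + z) = cinner_A A x y + cinner_A A x z"
  by (simp add: cinner_A_def cinner_add_right)

lemma cinner_A_diff_left: "cinner_A A (x - y) z = cinner_A A x z - cinner_A A y z"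
  by (simp add: cinner_A_def linear_diff[OF linear_positive_op] cinner_diff_left)

lemma cinner_A_diff_right: "cinner_A A x (y - z) = cinner_A A x y - cinner_A A x z"
  by (simp add: cinner_A_def cinner_diff_right)

lemma cinner_A_scaleC_left: "cinner_A A (c *\<^sub>C x) y = c * cinner_A A x y"
  using pos
  by (simp add: cinner_A_def positive_op_def bounded_clinear_scaleC cinner_scaleC_left)

lemma cinner_A_scaleC_right: "cinner_A A x (c *\<^sub>C y) = cnj c * cinner_A A x y"
  by (simp add: cinner_A_def cinner_scaleC_right)

lemma cinner_A_sum_left: "cinner_A A (\<Sum>i\<in>I. f i) y = (\<Sum>i\<in>I. cinner_A A (f i) y)"
  by (simp add: cinner_A_def linear_sum[OF linear_positive_op] cinner_sum_left)

lemma norm_A_nonneg: "0 \<le> norm_A A x"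
  using pos
  by (simp add: norm_A_def cinner_A_def positive_op_def complex_nonneg_Reals_iff)

lemma cinner_A_self: "cinner_A A x x = complex_of_real ((norm_A A x)\<^sup>2)"
proof -
  have "0 \<le> Re (cinner_A A x x)" "Im (cinner_A A x x) = 0"
    using pos by (auto simp: cinner_A_def positive_op_def complex_nonneg_Reals_iff)
  then show ?thesis
    by (simp add: norm_A_def complex_eq_iff)
qed

lemma norm_A_scaleC: "norm_A A (c *\<^sub>C x) = cmod c * norm_A A x"
proof -
  have "complex_of_real ((norm_A A (c *\<^sub>C x))\<^sup>2) = c * cnj c * complex_of_real ((norm_A A x)\<^sup>2)"
    unfolding cinner_A_self[symmetric] by (simp add: cinner_A_scaleC_left cinner_A_scaleC_right)
  also have "\<dots> = complex_of_real ((cmod c * norm_A A x)\<^sup>2)"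
    by (simp add: complex_norm_square[symmetric] power_mult_distrib)
  finally have "(norm_A A (c *\<^sub>C x))\<^sup>2 = (cmod c * norm_A A x)\<^sup>2"
    using of_real_eq_iff by blast
  then show ?thesis
    by (simp add: norm_A_nonneg)
qed

lemma norm_A_Cauchy_Schwarz: "cmod (cinner_A A x y) \<le> norm_A A x * norm_A A y"
proof -
  define z where "z = cinner_A A x y"
  define m where "m = (cmod z)\<^sup>2"
  define a where "a = (norm_A A x)\<^sup>2"
  define b where "b = (norm_A A y)\<^sup>2"
  have zz: "z * cnj z = complex_of_real m"
    unfolding m_def by (rule complex_norm_square[symmetric])
  \<comment> \<open>The phase of \<open>z\<close> in the coefficient turns the cross terms into \<open>\<bar>z\<bar>\<^sup>2\<close>.\<close>
  have quad: "0 \<le> a + 2 * t * m + t\<^sup>2 * m * b" for t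
  proof -
    let ?c = "complex_of_real t * z"
    have "complex_of_real ((norm_A A (x + ?c *\<^sub>C y))\<^sup>2)
        = complex_of_real a + cnj ?c * z + ?c * cnj z + ?c * cnj ?c * complex_of_real b"
      unfolding cinner_A_self[symmetric] a_def b_def z_def
      using cinner_A_commute[of y x]
      by (simp add: cinner_A_add_left cinner_A_add_right cinner_A_scaleC_left
          cinner_A_scaleC_right algebra_simps)
    also have "\<dots> = complex_of_real a + 2 * complex_of_real t * (z * cnj z)
        + (complex_of_real t)\<^sup>2 * (z * cnj z) * complex_of_real b"
      by (simp add: power2_eq_square algebra_simps)
    also have "\<dots> = complex_of_real (a + 2 * t * m + t\<^sup>2 * m * b)"
      by (simp add: zz)
    finally have "(norm_A A (x + ?c *\<^sub>C y))\<^sup>2 = a + 2 * t * m + t\<^sup>2 * m * b"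
      using of_real_eq_iff by blast
    then show ?thesis
      by (metis zero_le_power2)
  qed
  have "m \<le> a * b"
  proof (cases "b = 0")
    case True
    have "m = 0"
    proof (rule ccontr)
      assume "m \<noteq> 0"
      then show False
        using quad[of "- (a + 1) / (2 * m)"] True by (simp add: field_simps)
    qed
    then show ?thesis
      using True by simp
  next
    case False
    then have b: "0 < b"
      by (simp add: b_def)
    \<comment> \<open>The quadratic is smallest at \<open>t = - 1 / b\<close>.\<close>
    have "0 \<le> a - m / b"
      using quad[of "- 1 / b"] b by (simp add: field_simps power2_eq_square)
    then show ?thesis
      using b by (simp add: field_simps)
  qed
  then have "(cmod z)\<^sup>2 \<le> (norm_A A x * norm_A A y)\<^sup>2"
    by (simp add: m_def a_def b_def power_mult_distrib)
  then show ?thesis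
    unfolding z_def by (rule power2_le_imp_le) (simp add: norm_A_nonneg)
qed

lemma norm_A_eq_0_imp:
  assumes "norm_A A x = 0"
  shows "A x = 0"
proof -
  have "cinner_A A x (A x) = 0"
    using norm_A_Cauchy_Schwarz[of x "A x"] assms by simp
  then show ?thesis
    by (simp add: cinner_A_def)
qed

lemma norm_A_le_norm: "\<exists>c\<ge>0. \<forall>x. norm_A A x \<le> c * norm x"
proof -
  have bl: "bounded_linear A"
    using pos by (simp add: positive_op_def bounded_clinear_def)
  have "norm_A A x \<le> sqrt (onorm A) * norm x" for x
  proof -
    have "Re (cinner_A A x x) = A x \<bullet> x"
      by (simp add: cinner_A_def inner_eq_Re_cinner)
    also have "\<dots> \<le> norm (A x) * norm x"
      by (rule norm_cauchy_schwarz)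
    also have "\<dots> \<le> onorm A * norm x * norm x"
      by (intro mult_right_mono onorm[OF bl]) simp
    finally have "norm_A A x \<le> sqrt (onorm A * norm x * norm x)"
      by (simp add: norm_A_def)
    then show ?thesis
      by (simp add: real_sqrt_mult mult.assoc)
  qed
  then show ?thesis
    using onorm_pos_le[OF bl] by (intro exI[of _ "sqrt (onorm A)"]) auto
qed

section \<open>Boundedness of operators with an adjoint for the semi-inner product\<close>

text \<open>
  For an \<open>A\<close>-selfadjoint \<open>S\<close> the numbers \<open>norm_A A (S\<^sup>k x)\<close> are log-convex in \<open>k\<close> by
  Cauchy-Schwarz, so they grow at least geometrically with the first ratio
  \<open>norm_A A (S x) / norm_A A x\<close>.  As they grow at most like \<open>(onorm S)\<^sup>k\<close>, that ratio cannot
  exceed \<open>onorm S\<close>.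
\<close>

lemma selfadjoint_A_bounded:
  assumes S: "bounded_linear S"
    and sa: "\<And>x y. cinner_A A (S x) y = cinner_A A x (S y)"
  shows "norm_A A (S x) \<le> onorm S * norm_A A x"
proof (cases "norm_A A x = 0")
  case True
  have "cinner_A A (S x) (S x) = 0"
    using norm_A_Cauchy_Schwarz[of x "S (S x)"] True by (simp add: sa)
  then show ?thesis
    using True by (simp add: cinner_A_self)
next
  case False
  define p where "p = norm_A A x"
  define r where "r = norm_A A (S x) / p"
  define a where "a k = norm_A A ((S ^^ k) x)" for k
  have p: "0 < p"
    using False norm_A_nonneg[of x] by (simp add: p_def)
  have a0: "0 \<le> a k" for k
    by (simp add: a_def norm_A_nonneg)
  have log_convex: "a (Suc k) * a (Suc k) \<le> a k * a (Suc (Suc k))" for k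
  proof -
    have "complex_of_real ((a (Suc k))\<^sup>2) = cinner_A A ((S ^^ k) x) (S (S ((S ^^ k) x)))"
      unfolding a_def cinner_A_self[symmetric] by (simp add: sa)
    then have "cmod (complex_of_real ((a (Suc k))\<^sup>2)) \<le> a k * a (Suc (Suc k))"
      unfolding a_def using norm_A_Cauchy_Schwarz by simp
    then show ?thesis
      by (simp add: power2_eq_square norm_mult)
  qed
  have ratio: "r * a k \<le> a (Suc k)" for k
  proof (induction k)
    case 0
    then show ?case
      using p by (simp add: a_def r_def p_def)
  next
    case (Suc k)
    show ?case
    proof (cases "a k = 0")
      case True
      then have "(a (Suc k))\<^sup>2 \<le> 0"
        using log_convex[of k] by (simp add: power2_eq_square)
      then have "a (Suc k) = 0"
        by simp
      then show ?thesis
        using a0 by simp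
    next
      case False
      then have "0 < a k"
        using a0[of k] by simp
      have "a k * (r * a (Suc k)) = (r * a k) * a (Suc k)"
        by simp
      also have "\<dots> \<le> a (Suc k) * a (Suc k)"
        by (intro mult_right_mono Suc a0)
      also have "\<dots> \<le> a k * a (Suc (Suc k))"
        by (rule log_convex)
      finally show ?thesis
        using \<open>0 < a k\<close> by simp
    qed
  qed
  have r0: "0 \<le> r"
    using p by (simp add: r_def norm_A_nonneg)
  have lower: "r ^ k * p \<le> a k" for k
  proof (induction k)
    case 0
    then show ?case
      by (simp add: a_def p_def)
  next
    case (Suc k)
    have "r ^ Suc k * p \<le> r * a k"
      using mult_left_mono[OF Suc r0] by simp
    then show ?case
      using ratio[of k] by linarith
  qed
  obtain c where c: "0 \<le> c" "\<And>u. norm_A A u \<le> c * norm u"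
    using norm_A_le_norm by blast
  have grow: "norm ((S ^^ k) x) \<le> onorm S ^ k * norm x" for k
  proof (induction k)
    case (Suc k)
    have "norm (S ((S ^^ k) x)) \<le> onorm S * norm ((S ^^ k) x)"
      by (rule onorm[OF S])
    also have "\<dots> \<le> onorm S * (onorm S ^ k * norm x)"
      by (intro mult_left_mono Suc onorm_pos_le[OF S])
    finally show ?case
      by simp
  qed simp
  have upper: "a k \<le> c * norm x * onorm S ^ k" for k
  proof -
    have "a k \<le> c * norm ((S ^^ k) x)"
      unfolding a_def by (rule c)
    also have "\<dots> \<le> c * (onorm S ^ k * norm x)"
      by (intro mult_left_mono grow c)
    finally show ?thesis
      by (simp add: mult_ac)
  qed
  have "r \<le> onorm S"
  proof (rule ccontr)
    assume "\<not> r \<le> onorm S"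
    then have rS: "onorm S < r" and rpos: "0 < r"
      using onorm_pos_le[OF S] by linarith+
    have le: "p \<le> c * norm x * (onorm S / r) ^ k" for k
      using lower[of k] upper[of k] rpos by (simp add: power_divide field_simps)
    have "(\<lambda>k. c * norm x * (onorm S / r) ^ k) \<longlonglongrightarrow> c * norm x * 0"
      using rS rpos onorm_pos_le[OF S] by (intro tendsto_intros LIMSEQ_power_zero) auto
    then have "p \<le> c * norm x * 0"
      by (rule LIMSEQ_le_const) (use le in blast)
    then show False
      using p by simp
  qed
  then show ?thesis
    using p by (simp add: r_def p_def field_simps)
qed

text \<open>
  The identity \<open>\<langle>T x, T x\<rangle> = \<langle>x, X (T x)\<rangle>\<close> for the semi-inner product reduces the claim to the
  \<open>A\<close>-selfadjoint operator \<open>X \<circ> T\<close>.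
\<close>

lemma adjointable_A_bounded:
  assumes T: "bounded_linear T" and X: "bounded_linear X"
    and adj: "\<And>x y. cinner_A A (T x) y = cinner_A A x (X y)"
  shows "\<exists>K. \<forall>x. norm_A A (T x) \<le> K * norm_A A x"
proof -
  define S where "S x = X (T x)" for x
  have adj': "cinner_A A (X x) y = cinner_A A x (T y)" for x y
    using adj[of y x] cinner_A_commute[of "X x" y] cinner_A_commute[of x "T y"] by simp
  have S: "bounded_linear S"
    unfolding S_def by (rule bounded_linear_compose[OF X T])
  have sa: "cinner_A A (S x) y = cinner_A A x (S y)" for x y
    by (simp add: S_def adj adj')
  have "norm_A A (T x) \<le> sqrt (onorm S) * norm_A A x" for x
  proof -
    have "complex_of_real ((norm_A A (T x))\<^sup>2) = cinner_A A x (S x)"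
      unfolding cinner_A_self[symmetric] by (simp add: S_def adj)
    then have "cmod (complex_of_real ((norm_A A (T x))\<^sup>2)) \<le> norm_A A x * norm_A A (S x)"
      using norm_A_Cauchy_Schwarz by simp
    also have "\<dots> \<le> norm_A A x * (onorm S * norm_A A x)"
      by (intro mult_left_mono selfadjoint_A_bounded[OF S sa] norm_A_nonneg)
    also have "\<dots> = (sqrt (onorm S) * norm_A A x)\<^sup>2"
      using onorm_pos_le[OF S] by (simp add: power_mult_distrib power2_eq_square)
    finally have "(norm_A A (T x))\<^sup>2 \<le> (sqrt (onorm S) * norm_A A x)\<^sup>2"
      by (simp add: norm_power norm_A_nonneg)
    then show ?thesis
      by (rule power2_le_imp_le) (simp add: norm_A_nonneg onorm_pos_le[OF S])
  qed
  then show ?thesis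
    by blast
qed

lemma norm_A_le_opnorm_A:
  assumes T: "bounded_clinear T" and bd: "\<exists>K. \<forall>x. norm_A A (T x) \<le> K * norm_A A x"
  shows "norm_A A (T x) \<le> opnorm_A A T * norm_A A x"
proof -
  obtain K where K: "\<And>x. norm_A A (T x) \<le> K * norm_A A x"
    using bd by blast
  have bdd: "bdd_above {norm_A A (T x) | x. norm_A A x = 1}"
    using K by (intro bdd_aboveI[of _ K]) (auto, metis mult.right_neutral)
  show ?thesis
  proof (cases "norm_A A x = 0")
    case True
    then show ?thesis
      using K[of x] by simp
  next
    case False
    define q where "q = norm_A A x"
    define u where "u = complex_of_real (1 / q) *\<^sub>C x"
    have q: "0 < q"
      using False norm_A_nonneg[of x] by (simp add: q_def)
    have "norm_A A u = 1"
      using q by (simp add: u_def norm_A_scaleC q_def norm_divide)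
    then have "norm_A A (T u) \<le> opnorm_A A T"
      unfolding opnorm_A_def using bdd by (intro cSup_upper) auto
    moreover have "norm_A A (T u) = norm_A A (T x) / q"
      using q by (simp add: u_def bounded_clinear_scaleC[OF T] norm_A_scaleC norm_divide)
    ultimately show ?thesis
      using q by (simp add: q_def field_simps)
  qed
qed

text \<open>
  A nonzero \<open>A\<close> has vectors of nonzero seminorm, since \<open>A x\<close> vanishes whenever \<open>norm_A A x\<close>
  does, and such a vector can be normalized.
\<close>

lemma norm_A_attains_1:
  assumes "A \<noteq> (\<lambda>_. 0)"
  shows "\<exists>x. norm_A A x = 1"
proof -
  obtain x where "A x \<noteq> 0"
    using assms by auto
  then have "0 < norm_A A x"
    using norm_A_eq_0_imp norm_A_nonneg[of x] by (metis less_eq_real_def)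
  then have "norm_A A (complex_of_real (1 / norm_A A x) *\<^sub>C x) = 1"
    by (simp add: norm_A_scaleC norm_divide)
  then show ?thesis
    by blast
qed

section \<open>The distinguished adjoint and the real and imaginary parts\<close>

text \<open>
  A solution \<open>X\<close> of \<open>A X = T\<^sup>* A\<close> stays a solution after composing with the projection onto
  the closure of the range of \<open>A\<close>, because what the projection removes is orthogonal to that
  range and hence in the kernel of \<open>A\<close>.  The same orthogonality gives uniqueness.
\<close>

lemma sharp_A_solves:
  assumes "T \<in> B_A A"
  shows "bounded_clinear (sharp_A A T)" and "A (sharp_A A T x) = cadjoint T (A x)"
proof -
  let ?M = "closure (range A)"
  let ?sol = "\<lambda>X. bounded_clinear X \<and> A \<circ> X = cadjoint T \<circ> A \<and> range X \<subseteq> ?M"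
  have A: "bounded_clinear A"
    using pos by (simp add: positive_op_def)
  obtain X where X: "bounded_clinear X" "A \<circ> X = cadjoint T \<circ> A"
    using assms by (auto simp: B_A_def)
  have subR: "subspace (range A)"
    by (rule linear_subspace_image[OF linear_positive_op subspace_UNIV])
  have scl: "c *\<^sub>C z \<in> ?M" if "z \<in> ?M" for c z
  proof -
    have "range A \<subseteq> ?M"
      by (rule closure_subset)
    then have "c *\<^sub>C A u \<in> ?M" for u
      unfolding bounded_clinear_scaleC[OF A, symmetric] by blast
    then have "(*\<^sub>C) c ` range A \<subseteq> ?M"
      by blast
    then have "closure ((*\<^sub>C) c ` range A) \<subseteq> ?M"
      by (rule closure_minimal) simp
    moreover have "(*\<^sub>C) c ` ?M \<subseteq> closure ((*\<^sub>C) c ` range A)"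
      by (intro closure_bounded_linear_image_subset bounded_linear_scaleC)
    ultimately show ?thesis
      using that by blast
  qed
  have sub: "subspace ?M"
  proof (rule subspaceI)
    show "0 \<in> ?M"
      by (rule subsetD[OF closure_subset subspace_0[OF subR]])
    show "u + v \<in> ?M" if uv: "u \<in> ?M" "v \<in> ?M" for u v
    proof -
      obtain f g where "\<forall>n. f n \<in> range A" "f \<longlonglongrightarrow> u" "\<forall>n. g n \<in> range A" "g \<longlonglongrightarrow> v"
        using uv unfolding closure_sequential by blast
      then have "\<forall>n. f n + g n \<in> range A" "(\<lambda>n. f n + g n) \<longlonglongrightarrow> u + v"
        by (simp_all add: subspace_add[OF subR] tendsto_add)
      then show ?thesis
        unfolding closure_sequential by (intro exI[of _ "\<lambda>n. f n + g n"] conjI)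
    qed
    show "r *\<^sub>R u \<in> ?M" if "u \<in> ?M" for r u
      unfolding scaleR_scaleC by (rule scl[OF that])
  qed
  have kernel: "z = 0" if "z \<in> ?M" "A z = 0" for z
  proof -
    have "closed {w. cinner w z = 0}"
      by (intro closed_Collect_eq continuous_cinner_left continuous_on_const)
    moreover have "range A \<subseteq> {w. cinner w z = 0}"
      using that(2) by (auto simp: positive_op_hermitian[OF pos])
    ultimately have "?M \<subseteq> {w. cinner w z = 0}"
      by (rule closure_minimal[rotated])
    then show ?thesis
      using that(1) by auto
  qed
  obtain P where P: "bounded_clinear P" "range P \<subseteq> ?M"
    and orth: "\<And>x z. z \<in> ?M \<Longrightarrow> cinner (x - P x) z = 0"
    using orthogonal_projection_exists[OF sub scl closed_closure] by metis
  have AP: "A (P x) = A x" for x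
  proof -
    have "cinner (A (x - P x)) (A (x - P x)) = cinner (x - P x) (A (A (x - P x)))"
      by (rule positive_op_hermitian[OF pos])
    also have "\<dots> = 0"
      by (intro orth subsetD[OF closure_subset] rangeI)
    finally show ?thesis
      by (simp add: linear_diff[OF linear_positive_op])
  qed
  have ex: "?sol (\<lambda>x. P (X x))"
    using X P bounded_clinear_compose[OF P(1) X(1)] by (auto simp: AP fun_eq_iff)
  have "?sol (sharp_A A T)"
    unfolding sharp_A_def
  proof (rule theI[where P = ?sol and a = "\<lambda>x. P (X x)"])
    show "?sol (\<lambda>x. P (X x))"
      by (rule ex)
  next
    fix Y assume Y: "?sol Y"
    have "Y x - P (X x) = 0" for x
    proof (rule kernel)
      show "Y x - P (X x) \<in> ?M"
        using Y ex by (intro subspace_diff[OF sub]) auto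
      have "A (Y x) = A (P (X x))"
        using Y ex by (metis comp_apply)
      then show "A (Y x - P (X x)) = 0"
        by (simp add: linear_diff[OF linear_positive_op])
    qed
    then show "Y = (\<lambda>x. P (X x))"
      by auto
  qed
  then show "bounded_clinear (sharp_A A T)" "A (sharp_A A T x) = cadjoint T (A x)"
    by (auto simp: fun_eq_iff)
qed

lemma B_A_bounded_clinear: "T \<in> B_A A \<Longrightarrow> bounded_clinear T"
  by (simp add: B_A_def)

lemma cinner_A_sharp_A:
  assumes "T \<in> B_A A"
  shows "cinner_A A (T x) y = cinner_A A x (sharp_A A T y)"
  unfolding cinner_A_def positive_op_hermitian[OF pos]
  by (simp add: cinner_cadjoint[OF B_A_bounded_clinear[OF assms]] sharp_A_solves(2)[OF assms])

lemma cinner_A_sharp_A_left: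
  assumes "T \<in> B_A A"
  shows "cinner_A A (sharp_A A T x) y = cinner_A A x (T y)"
  using cinner_A_sharp_A[OF assms, of y x] cinner_A_commute[of "sharp_A A T x" y]
    cinner_A_commute[of x "T y"] by simp

lemma B_A_norm_A_le:
  assumes "T \<in> B_A A"
  shows "norm_A A (T x) \<le> opnorm_A A T * norm_A A x"
proof (rule norm_A_le_opnorm_A)
  show "\<exists>K. \<forall>x. norm_A A (T x) \<le> K * norm_A A x"
    using B_A_bounded_clinear[OF assms] sharp_A_solves(1)[OF assms] cinner_A_sharp_A[OF assms]
    by (intro adjointable_A_bounded) (auto simp: bounded_clinear_def)
qed (rule B_A_bounded_clinear[OF assms])

text \<open>
  An \<open>A\<close>-selfadjoint operator is \<open>A\<close>-bounded, so its seminorm is a genuine Lipschitz constant and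
  Cauchy-Schwarz applies.
\<close>

lemma selfadjoint_numerical_bound:
  assumes S: "bounded_clinear S"
    and sa: "\<And>x y. cinner_A A (S x) y = cinner_A A x (S y)"
  shows "cmod (cinner_A A (S x) x) \<le> opnorm_A A S * (norm_A A x)\<^sup>2"
proof -
  have bl: "bounded_linear S"
    using S by (simp add: bounded_clinear_def)
  have "cmod (cinner_A A (S x) x) \<le> norm_A A (S x) * norm_A A x"
    by (rule norm_A_Cauchy_Schwarz)
  also have "\<dots> \<le> opnorm_A A S * norm_A A x * norm_A A x"
    using selfadjoint_A_bounded[OF bl sa]
    by (intro mult_right_mono norm_A_le_opnorm_A[OF S] norm_A_nonneg) blast
  finally show ?thesis
    by (simp add: power2_eq_square mult.assoc)
qed

lemma bounded_clinear_scaleC_op: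
  fixes S :: "'a \<Rightarrow> 'a"
  assumes "bounded_clinear S"
  shows "bounded_clinear (\<lambda>x. c *\<^sub>C S x)"
  using assms bounded_linear_compose[OF bounded_linear_scaleC[of c]]
  by (auto simp: bounded_clinear_def scaleC_scaleC mult.commute)

text \<open>
  The operator \<open>Re_A A T\<close> is \<open>A\<close>-selfadjoint and its quadratic form is the real part of that of
  \<open>T\<close>, because \<open>T\<close> and its distinguished adjoint have conjugate quadratic forms.  The same
  argument with \<open>Im_A A T\<close> yields the imaginary part.
\<close>

lemma Re_cinner_A_le:
  assumes T: "T \<in> B_A A"
  shows "\<bar>Re (cinner_A A (T x) x)\<bar> \<le> opnorm_A A (Re_A A T) * (norm_A A x)\<^sup>2"
proof -
  have "bounded_clinear (\<lambda>x. T x + sharp_A A T x)"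
    using B_A_bounded_clinear[OF T] sharp_A_solves(1)[OF T]
    by (auto simp: bounded_clinear_def bounded_linear_add scaleC_add_right)
  then have bc: "bounded_clinear (Re_A A T)"
    unfolding Re_A_def by (rule bounded_clinear_scaleC_op)
  have sa: "cinner_A A (Re_A A T u) v = cinner_A A u (Re_A A T v)" for u v
    by (simp add: Re_A_def cinner_A_scaleC_left cinner_A_scaleC_right cinner_A_add_left
        cinner_A_add_right cinner_A_sharp_A[OF T] cinner_A_sharp_A_left[OF T])
  have "cinner_A A (Re_A A T x) x
      = (1 / 2) * (cinner_A A (T x) x + cnj (cinner_A A (T x) x))"
    using cinner_A_commute[of x "T x"]
    by (simp add: Re_A_def cinner_A_scaleC_left cinner_A_add_left cinner_A_sharp_A_left[OF T])
  also have "\<dots> = complex_of_real (Re (cinner_A A (T x) x))"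
    by (simp add: complex_add_cnj)
  finally show ?thesis
    using selfadjoint_numerical_bound[OF bc sa, of x] by simp
qed

lemma Im_cinner_A_le:
  assumes T: "T \<in> B_A A"
  shows "\<bar>Im (cinner_A A (T x) x)\<bar> \<le> opnorm_A A (Im_A A T) * (norm_A A x)\<^sup>2"
proof -
  have "bounded_clinear (\<lambda>x. T x - sharp_A A T x)"
    using B_A_bounded_clinear[OF T] sharp_A_solves(1)[OF T]
    by (auto simp: bounded_clinear_def bounded_linear_sub scaleC_diff_right)
  then have bc: "bounded_clinear (Im_A A T)"
    unfolding Im_A_def by (rule bounded_clinear_scaleC_op)
  have sa: "cinner_A A (Im_A A T u) v = cinner_A A u (Im_A A T v)" for u v
    by (simp add: Im_A_def cinner_A_scaleC_left cinner_A_scaleC_right cinner_A_diff_left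
        cinner_A_diff_right cinner_A_sharp_A[OF T] cinner_A_sharp_A_left[OF T] field_simps)
  have "cinner_A A (Im_A A T x) x
      = (1 / (2 * \<i>)) * (cinner_A A (T x) x - cnj (cinner_A A (T x) x))"
    using cinner_A_commute[of x "T x"]
    by (simp add: Im_A_def cinner_A_scaleC_left cinner_A_diff_left cinner_A_sharp_A_left[OF T])
  also have "\<dots> = complex_of_real (Im (cinner_A A (T x) x))"
    by (simp add: complex_diff_cnj mult.commute[of _ \<i>])
  finally show ?thesis
    using selfadjoint_numerical_bound[OF bc sa, of x] by simp
qed

end

section \<open>The numerical radius of an operator matrix\<close>

text \<open>
  The left side is the quadratic form of the matrix with rows \<open>(a, s/2)\<close> and \<open>(s/2, 0)\<close> at
  the unit vector \<open>(t, w)\<close>, and the right side is the largest eigenvalue of that matrix.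
\<close>

lemma quadratic_form_le_largest_eigenvalue:
  fixes a s t w :: real
  assumes "t\<^sup>2 + w\<^sup>2 = 1"
  shows "a * t\<^sup>2 + s * t * w \<le> (a + sqrt (a\<^sup>2 + s\<^sup>2)) / 2"
proof -
  \<comment> \<open>In double angles the form is \<open>(a + a cos 2\<theta> + s sin 2\<theta>) / 2\<close>.\<close>
  define c where "c = t\<^sup>2 - w\<^sup>2"
  define e where "e = 2 * t * w"
  have "c\<^sup>2 + e\<^sup>2 = (t\<^sup>2 + w\<^sup>2)\<^sup>2"
    unfolding c_def e_def by algebra
  then have ce: "c\<^sup>2 + e\<^sup>2 = 1"
    using assms by simp
  have "(a * c + s * e)\<^sup>2 = (a\<^sup>2 + s\<^sup>2) * (c\<^sup>2 + e\<^sup>2) - (a * e - s * c)\<^sup>2"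
    by algebra
  then have "(a * c + s * e)\<^sup>2 \<le> a\<^sup>2 + s\<^sup>2"
    using ce by simp
  then have "a * c + s * e \<le> sqrt (a\<^sup>2 + s\<^sup>2)"
    by (rule real_le_rsqrt)
  moreover have "2 * (a * t\<^sup>2 + s * t * w) = a * (t\<^sup>2 + w\<^sup>2) + a * c + s * e"
    by (simp add: c_def e_def algebra_simps)
  ultimately show ?thesis
    using assms by simp
qed

text \<open>
  Here \<open>t j\<close> stands for the seminorm of the \<open>j\<close>-th component of a unit vector, \<open>n j\<close> for the
  seminorm of the \<open>j\<close>-th entry of row \<open>i\<close>, and \<open>z\<close> for the real or imaginary part of the
  contribution of that row.  Cauchy-Schwarz over \<open>j \<noteq> i\<close> reduces the sum to the two unit
  coordinates \<open>t i\<close> and \<open>w = sqrt (1 - (t i)\<^sup>2)\<close>.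
\<close>

lemma row_estimate:
  fixes t n :: "'n::finite \<Rightarrow> real"
  assumes "(\<Sum>j\<in>UNIV. (t j)\<^sup>2) = 1" and "0 \<le> t i"
    and z: "\<bar>z\<bar> \<le> a * (t i)\<^sup>2 + (\<Sum>j\<in>UNIV - {i}. n j * t j * t i)"
  shows "\<bar>z\<bar> \<le> (a + sqrt (a\<^sup>2 + (\<Sum>j\<in>UNIV - {i}. (n j)\<^sup>2))) / 2"
proof -
  let ?J = "UNIV - {i}"
  define s where "s = sqrt (\<Sum>j\<in>?J. (n j)\<^sup>2)"
  define w where "w = sqrt (\<Sum>j\<in>?J. (t j)\<^sup>2)"
  have s2: "s\<^sup>2 = (\<Sum>j\<in>?J. (n j)\<^sup>2)" and w2: "w\<^sup>2 = (\<Sum>j\<in>?J. (t j)\<^sup>2)"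
    by (simp_all add: s_def w_def sum_nonneg)
  have "(t i)\<^sup>2 + w\<^sup>2 = 1"
    using assms(1) unfolding w2 by (subst (asm) sum.remove[of _ i]) auto
  note eig = quadratic_form_le_largest_eigenvalue[OF this, of a s]
  have "(\<Sum>j\<in>?J. n j * t j)\<^sup>2 \<le> (s * w)\<^sup>2"
    using Cauchy_Schwarz_ineq_sum[of n t ?J] by (simp add: power_mult_distrib s2 w2)
  then have "(\<Sum>j\<in>?J. n j * t j) \<le> s * w"
    by (rule power2_le_imp_le) (simp add: s_def w_def sum_nonneg)
  then have "(\<Sum>j\<in>?J. n j * t j) * t i \<le> s * w * t i"
    using assms(2) by (rule mult_right_mono)
  then have "(\<Sum>j\<in>?J. n j * t j * t i) \<le> s * t i * w"
    by (simp only: sum_distrib_right mult.assoc mult.commute[of w])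
  then have "\<bar>z\<bar> \<le> a * (t i)\<^sup>2 + s * t i * w"
    using z by linarith
  with eig show ?thesis
    by (simp add: s2)
qed

lemma diag_op_nth: "linear A \<Longrightarrow> diag_op A x $ i = A (x $ i)"
  by (simp add: diag_op_def op_matrix_def if_distrib[of "\<lambda>f. f _"] cong: if_cong)

lemma cinner_A_diag_op:
  "linear A \<Longrightarrow> cinner_A (diag_op A) x y = (\<Sum>i\<in>UNIV. cinner_A A (x $ i) (y $ i))"
  by (simp add: cinner_A_def cinner_vec_def diag_op_nth)

theorem theorem2p5:
  fixes A :: "'a::complex_hilbert \<Rightarrow> 'a"
    and T :: "'n::finite \<Rightarrow> 'n \<Rightarrow> 'a \<Rightarrow> 'a"
    and lam mu :: "'n \<Rightarrow> real"
  assumes "positive_op A" and "A \<noteq> (\<lambda>_. 0)"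
    and "\<And>i j. T i j \<in> B_A A"
    and "\<And>i. lam i = opnorm_A A (Re_A A (T i i))
      + sqrt ((opnorm_A A (Re_A A (T i i)))\<^sup>2 + (\<Sum>j\<in>UNIV - {i}. (opnorm_A A (T i j))\<^sup>2))"
    and "\<And>i. mu i = opnorm_A A (Im_A A (T i i))
      + sqrt ((opnorm_A A (Im_A A (T i i)))\<^sup>2 + (\<Sum>j\<in>UNIV - {i}. (opnorm_A A (T i j))\<^sup>2))"
  shows "numradius_A (diag_op A) (op_matrix T)
    \<le> 1 / 2 * (\<Sum>i\<in>UNIV. sqrt ((lam i)\<^sup>2 + (mu i)\<^sup>2))"
proof -
  note pos = assms(1) and TB = assms(3)
  note lin = linear_positive_op[OF pos]
  have norm_diag: "norm_A (diag_op A) x = sqrt (\<Sum>i\<in>UNIV. (norm_A A (x $ i))\<^sup>2)"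
    for x :: "'a ^ 'n"
    by (simp add: norm_A_def[of "diag_op A"] cinner_A_diag_op[OF lin] cinner_A_self[OF pos])
  have bound: "cmod (cinner_A (diag_op A) (op_matrix T x) x)
      \<le> 1 / 2 * (\<Sum>i\<in>UNIV. sqrt ((lam i)\<^sup>2 + (mu i)\<^sup>2))"
    if "norm_A (diag_op A) x = 1" for x :: "'a ^ 'n"
  proof -
    define t where "t i = norm_A A (x $ i)" for i
    have t1: "(\<Sum>i\<in>UNIV. (t i)\<^sup>2) = 1"
      using that by (simp add: norm_diag t_def)
    have t0: "0 \<le> t i" for i
      by (simp add: t_def norm_A_nonneg[OF pos])
    define e where "e i j = cinner_A A (T i j (x $ j)) (x $ i)" for i j
    have e_le: "cmod (e i j) \<le> opnorm_A A (T i j) * t j * t i" for i j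
      unfolding e_def t_def
      by (rule order_trans[OF norm_A_Cauchy_Schwarz[OF pos]])
        (intro mult_right_mono B_A_norm_A_le[OF pos TB] norm_A_nonneg[OF pos])
    define z where "z i = (\<Sum>j\<in>UNIV. e i j)" for i
    have z_split: "z i = e i i + (\<Sum>j\<in>UNIV - {i}. e i j)" for i
      unfolding z_def by (rule sum.remove) auto
    have off: "cmod (\<Sum>j\<in>UNIV - {i}. e i j)
        \<le> (\<Sum>j\<in>UNIV - {i}. opnorm_A A (T i j) * t j * t i)" for i
      by (intro sum_norm_le e_le)
    have "\<bar>Re (z i)\<bar> \<le> lam i / 2" for i
      unfolding assms(4)
    proof (rule row_estimate[OF t1 t0])
      have "\<bar>Re (z i)\<bar> \<le> \<bar>Re (e i i)\<bar> + cmod (\<Sum>j\<in>UNIV - {i}. e i j)"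
        unfolding z_split plus_complex.sel
        using abs_Re_le_cmod[of "\<Sum>j\<in>UNIV - {i}. e i j"] by linarith
      also have "\<dots> \<le> opnorm_A A (Re_A A (T i i)) * (t i)\<^sup>2
          + (\<Sum>j\<in>UNIV - {i}. opnorm_A A (T i j) * t j * t i)"
        using Re_cinner_A_le[OF pos TB] off by (intro add_mono) (auto simp: e_def t_def)
      finally show "\<bar>Re (z i)\<bar> \<le> \<dots>" .
    qed
    moreover have "\<bar>Im (z i)\<bar> \<le> mu i / 2" for i
      unfolding assms(5)
    proof (rule row_estimate[OF t1 t0])
      have "\<bar>Im (z i)\<bar> \<le> \<bar>Im (e i i)\<bar> + cmod (\<Sum>j\<in>UNIV - {i}. e i j)"
        unfolding z_split plus_complex.sel
        using abs_Im_le_cmod[of "\<Sum>j\<in>UNIV - {i}. e i j"] by linarith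
      also have "\<dots> \<le> opnorm_A A (Im_A A (T i i)) * (t i)\<^sup>2
          + (\<Sum>j\<in>UNIV - {i}. opnorm_A A (T i j) * t j * t i)"
        using Im_cinner_A_le[OF pos TB] off by (intro add_mono) (auto simp: e_def t_def)
      finally show "\<bar>Im (z i)\<bar> \<le> \<dots>" .
    qed
    ultimately have z_le: "cmod (z i) \<le> sqrt ((lam i)\<^sup>2 + (mu i)\<^sup>2) / 2" for i
    proof -
      assume re: "\<And>i. \<bar>Re (z i)\<bar> \<le> lam i / 2" and im: "\<And>i. \<bar>Im (z i)\<bar> \<le> mu i / 2"
      have "(Re (z i))\<^sup>2 \<le> (lam i / 2)\<^sup>2" "(Im (z i))\<^sup>2 \<le> (mu i / 2)\<^sup>2"
        using power_mono[OF re[of i] abs_ge_zero, of 2] power_mono[OF im[of i] abs_ge_zero, of 2]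
        by simp_all
      then have "cmod (z i) \<le> sqrt (((lam i)\<^sup>2 + (mu i)\<^sup>2) / 2\<^sup>2)"
        unfolding cmod_def by (intro real_sqrt_le_mono) (simp add: power_divide)
      then show ?thesis
        by (simp add: real_sqrt_divide)
    qed
    have "cinner_A (diag_op A) (op_matrix T x) x = (\<Sum>i\<in>UNIV. z i)"
      by (simp add: cinner_A_diag_op[OF lin] op_matrix_def cinner_A_sum_left[OF pos] z_def e_def)
    then have "cmod (cinner_A (diag_op A) (op_matrix T x) x)
        \<le> (\<Sum>i\<in>UNIV. sqrt ((lam i)\<^sup>2 + (mu i)\<^sup>2) / 2)"
      using z_le by (simp add: sum_norm_le)
    then show ?thesis
      by (simp add: sum_divide_distrib)
  qed
  \<comment> \<open>A supremum of reals is bounded by an upper bound only over a nonempty set, so a vector of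
     unit seminorm is needed; one supported in a single coordinate, no matter which, will do.\<close>
  obtain u where u: "norm_A A u = 1"
    using norm_A_attains_1[OF pos assms(2)] by blast
  have "norm_A A 0 = 0"
    by (simp add: norm_A_def cinner_A_def)
  then have "(\<Sum>i\<in>UNIV. (norm_A A (axis k u $ i))\<^sup>2) = 1" for k :: 'n
    using u by (simp add: axis_def if_distrib[of "norm_A A"] if_distrib[of "\<lambda>r. r\<^sup>2"] cong: if_cong)
  then have "norm_A (diag_op A) (axis (undefined :: 'n) u) = 1"
    by (simp add: norm_diag)
  then show ?thesis
    unfolding numradius_A_def using bound by (intro cSup_least) auto
qed

end
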